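(* Let $A|H$, $B|K$ be two conditional events with $AH\neq\emptyset$. For each $i\in\{K,L,B,S,gs\}$, coherence requires that $$\mathbb{P}[(A|H)\wedge_i(B|K)]=\mathbb{P}[(B|K)|_i(A|H)]\,P(A|H),$$ that is, every coherent assessment $(x,y,z_i,\mu_i)$ on $\{A|H,\ B|K,\ (A|H)\wedge_i(B|K),\ (B|K)|_i(A|H)\}$ satisfies $z_i=\mu_i x$. (For $i\in\{K,L,B,S\}$ the conjunction is a conditional event and its prevision $\mathbb{P}$ is its probability $P$.)
   Context: Events are two-valued entities identified with their indicators (values $1/0$); $\emptyset$ is the impossible event, $AB=A\wedge B$, $\overline{A}$ is the negation. For $H\neq\emptyset$ the conditional event $E|H$ is true if $EH$ is true, false if $\overline{E}H$ is true, void if $\overline{H}$ is true. Only conditional events and conditional random quantities with non-impossible conditioning event are considered. Once $P(E|H)=p$ is assessed, $E|H$ is also the random quantity $EH+p\overline{H}$; numerically $\overline{A}|H=1-A|H$. More generally, for a random quantity $X$ with finitely many values, once the prevision $\mathbb{P}(X|H)=\mu$ is assessed (the amount paid to receive $X$ if $H$ is true and $\mu$ back if $H$ is false), $X|H$ is the random quantity $XH+\mu\overline{H}$. Conjunctions (the subscripts $K,L,B,S,gs$ are only names, unrelated to the events). The first four are conditional events: $(A|H)\wedge_K(B|K)=AHBK|(HK\vee\overline{A}H\vee\overline{B}K)$; $(A|H)\wedge_L(B|K)=AHBK|(AHBK\vee\overline{A}H\vee\overline{B}K\vee\overline{H}\,\overline{K})$; $(A|H)\wedge_B(B|K)=AHBK|HK$;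 $(A|H)\wedge_S(B|K)=((AH\vee\overline{H})\wedge(BK\vee\overline{K}))|(H\vee K)$. The fifth is a conditional random quantity, defined once $P(A|H)$ and $P(B|K)$ are assessed: $(A|H)\wedge_{gs}(B|K)=(AHBK+P(A|H)\,\overline{H}BK+P(B|K)\,AH\overline{K})|(H\vee K)$. Iterated conditional: for each $i\in\{K,L,B,S,gs\}$, $(B|K)|_i(A|H)$ is the random quantity $(A|H)\wedge_i(B|K)+\mu_i\,(\overline{A}|H)$, where $\mu_i=\mathbb{P}[(B|K)|_i(A|H)]$ is its assessed prevision (the amount paid to receive it), and the right-hand side is computed numerically from $x=P(A|H)$, $y=P(B|K)$, $z_i=\mathbb{P}[(A|H)\wedge_i(B|K)]$ and $\mu_i$. Coherence: an assessment of real values $m_j$ on a finite family of such objects $X_j$ (conditional events as random quantities, conditional random quantities, and iterated conditionals) is coherent iff for every nonempty subfamily $J$ and all reals $s_j$, the random gain $\sum_{j\in J}s_j(X_j-m_j)$, restricted to the cases where at least one of the bets in $J$ is not called off, has minimum $\le 0$ and maximum $\ge 0$. A bet on a conditional event or on a conditional random quantity is called off when its conditioning event is false; a bet on an iterated conditional is called off in the cases where one receives back the paid amount whatever that amount is. *)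

theory Defs
  imports Complex_Main "HOL-Library.Indicator_Function"
begin

text \<open>Events are sets of elementary cases of type \<open>'w\<close>: negation is complement and the
  impossible event is \<open>{}\<close>. Since \<open>'w\<close> is arbitrary, so are the logical relations among events.\<close>

datatype 'w cond_event = Given (event: "'w set") (cond: "'w set")  (infix "given" 55)

datatype 'w cond_rq = CondRQ (rq: "'w \<Rightarrow> real") (rq_cond: "'w set")

fun cond_rq_of_event :: "'w cond_event \<Rightarrow> 'w cond_rq" where
  "cond_rq_of_event (E given H) = CondRQ (indicator E) H"

text \<open>The random quantity \<open>X H + m (- H)\<close> that \<open>X | H\<close> becomes once its prevision is
  assessed to be \<open>m\<close>.\<close>

fun rq_value :: "'w cond_rq \<Rightarrow> real \<Rightarrow> 'w \<Rightarrow> real" where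
  "rq_value (CondRQ X H) m \<omega> = X \<omega> * indicator H \<omega> + m * indicator (- H) \<omega>"

definition event_value :: "'w cond_event \<Rightarrow> real \<Rightarrow> 'w \<Rightarrow> real" where
  "event_value C p = rq_value (cond_rq_of_event C) p"

fun conj_K :: "'w cond_event \<Rightarrow> 'w cond_event \<Rightarrow> 'w cond_event" where
  "conj_K (A given H) (B given K) =
     (A \<inter> H \<inter> B \<inter> K given (H \<inter> K) \<union> (- A \<inter> H) \<union> (- B \<inter> K))"

fun conj_L :: "'w cond_event \<Rightarrow> 'w cond_event \<Rightarrow> 'w cond_event" where
  "conj_L (A given H) (B given K) =
     (A \<inter> H \<inter> B \<inter> K given
        (A \<inter> H \<inter> B \<inter> K) \<union> (- A \<inter> H) \<union> (- B \<inter> K) \<union> (- H \<inter> - K))"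

fun conj_B :: "'w cond_event \<Rightarrow> 'w cond_event \<Rightarrow> 'w cond_event" where
  "conj_B (A given H) (B given K) = (A \<inter> H \<inter> B \<inter> K given H \<inter> K)"

fun conj_S :: "'w cond_event \<Rightarrow> 'w cond_event \<Rightarrow> 'w cond_event" where
  "conj_S (A given H) (B given K) =
     (((A \<inter> H) \<union> - H) \<inter> ((B \<inter> K) \<union> - K) given H \<union> K)"

text \<open>Here \<open>x\<close> and \<open>y\<close> are the assessed probabilities of the two conditional events.\<close>

fun conj_gs :: "'w cond_event \<Rightarrow> 'w cond_event \<Rightarrow> real \<Rightarrow> real \<Rightarrow> 'w cond_rq" where
  "conj_gs (A given H) (B given K) x y =
     CondRQ (\<lambda>\<omega>. indicator (A \<inter> H \<inter> B \<inter> K) \<omega>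
                 + x * indicator (- H \<inter> B \<inter> K) \<omega>
                 + y * indicator (A \<inter> H \<inter> - K) \<omega>)
            (H \<union> K)"

datatype conj_kind = Kind_K | Kind_L | Kind_B | Kind_S | Kind_gs

fun cond_conj ::
  "conj_kind \<Rightarrow> 'w cond_event \<Rightarrow> 'w cond_event \<Rightarrow> real \<Rightarrow> real \<Rightarrow> 'w cond_rq" where
  "cond_conj Kind_K C D x y = cond_rq_of_event (conj_K C D)"
| "cond_conj Kind_L C D x y = cond_rq_of_event (conj_L C D)"
| "cond_conj Kind_B C D x y = cond_rq_of_event (conj_B C D)"
| "cond_conj Kind_S C D x y = cond_rq_of_event (conj_S C D)"
| "cond_conj Kind_gs C D x y = conj_gs C D x y"

text \<open>The iterated conditional \<open>D |\<^sub>i C\<close> (conditioning on \<open>C\<close>), where \<open>x\<close>, \<open>y\<close>, \<open>z\<close>, \<open>\<mu>\<close> are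
  the values assessed for \<open>C\<close>, \<open>D\<close>, their conjunction, and \<open>D |\<^sub>i C\<close> itself. The negation of
  \<open>C\<close> has numerical value one minus that of \<open>C\<close>.\<close>

definition iter_value ::
  "conj_kind \<Rightarrow> 'w cond_event \<Rightarrow> 'w cond_event \<Rightarrow> real \<Rightarrow> real \<Rightarrow> real \<Rightarrow> real \<Rightarrow> 'w \<Rightarrow> real" where
  "iter_value i C D x y z \<mu> \<omega> =
     rq_value (cond_conj i C D x y) z \<omega> + \<mu> * (1 - event_value C x \<omega>)"

record 'w bet =
  payoff :: "'w \<Rightarrow> real"
  price :: real
  called_off :: "'w set"

definition rq_bet :: "'w cond_rq \<Rightarrow> real \<Rightarrow> 'w bet" where
  "rq_bet X m = \<lparr>payoff = rq_value X m, price = m, called_off = - rq_cond X\<rparr>"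

definition event_bet :: "'w cond_event \<Rightarrow> real \<Rightarrow> 'w bet" where
  "event_bet C p = \<lparr>payoff = event_value C p, price = p, called_off = - cond C\<rparr>"

text \<open>The bet on the iterated conditional is called off in the cases where the paid amount
  \<open>t\<close> is returned for every \<open>t\<close>, with \<open>x\<close>, \<open>y\<close>, \<open>z\<close> held fixed.\<close>

definition iter_bet ::
  "conj_kind \<Rightarrow> 'w cond_event \<Rightarrow> 'w cond_event \<Rightarrow> real \<Rightarrow> real \<Rightarrow> real \<Rightarrow> real \<Rightarrow> 'w bet" where
  "iter_bet i C D x y z \<mu> =
     \<lparr>payoff = iter_value i C D x y z \<mu>, price = \<mu>,
      called_off = {\<omega>. \<forall>t. iter_value i C D x y z t \<omega> = t}\<rparr>"

definition gain :: "'w bet list \<Rightarrow> nat set \<Rightarrow> (nat \<Rightarrow> real) \<Rightarrow> 'w \<Rightarrow> real" where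
  "gain bs J s \<omega> = (\<Sum>j\<in>J. s j * (payoff (bs ! j) \<omega> - price (bs ! j)))"

definition active_cases :: "'w bet list \<Rightarrow> nat set \<Rightarrow> 'w set" where
  "active_cases bs J = {\<omega>. \<exists>j\<in>J. \<omega> \<notin> called_off (bs ! j)}"

text \<open>For bets whose payoffs take finitely many values, as all those above do, the set of gains is
  finite, so \<open>Min\<close> and \<open>Max\<close> are meaningful on it as soon as it is nonempty. If every bet in
  \<open>J\<close> is called off in all cases, there is nothing to check; this does not happen when all
  conditioning events, and in \<open>D |\<^sub>i C\<close> also \<open>event C \<inter> cond C\<close>, are not impossible.\<close>

definition coherent :: "'w bet list \<Rightarrow> bool" where
  "coherent bs \<longleftrightarrow>
     (\<forall>J s. J \<subseteq> {..<length bs} \<and> J \<noteq> {} \<and> active_cases bs J \<noteq> {} \<longrightarrow>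
        Min (gain bs J s ` active_cases bs J) \<le> 0 \<and>
        Max (gain bs J s ` active_cases bs J) \<ge> 0)"

end

theory Submission
  imports Defs
begin

text \<open>
  Write \<open>W\<close> for the numerical value of the conjunction (with its price \<open>z\<close> filled in where it is
  void) and \<open>X\<close> for that of \<open>A|H\<close>. Buying the iterated conditional yields
  \<open>W + \<mu> (1 - X) - \<mu> = W - \<mu> X\<close> in every case. Selling the conjunction and buying \<open>\<mu>\<close> units of
  \<open>A|H\<close> on top of that cancels both random quantities and leaves the sure gain \<open>z - \<mu> x\<close>, which
  coherence forces to be \<open>0\<close>. Only the shape of the iterated conditional enters, so the five
  conjunctions are treated alike.
\<close>

lemma coherent_sure_gain_zero:
  assumes "coherent bs" "J \<subseteq> {..<length bs}" "J \<noteq> {}" "active_cases bs J \<noteq> {}"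
    and sure: "\<And>\<omega>. \<omega> \<in> active_cases bs J \<Longrightarrow> gain bs J s \<omega> = c"
  shows "c = 0"
proof -
  have "gain bs J s ` active_cases bs J = {c}"
    using assms(4) sure by force
  moreover have "Min (gain bs J s ` active_cases bs J) \<le> 0 \<and>
                 Max (gain bs J s ` active_cases bs J) \<ge> 0"
    using assms(1-4) unfolding coherent_def by blast
  ultimately show ?thesis by simp
qed

theorem mainTheorem16:
  fixes A H B K :: "'w set" and x y z \<mu> :: real and i :: conj_kind
  assumes "H \<noteq> {}" and "K \<noteq> {}"
    and "A \<inter> H \<noteq> {}"
    and "rq_cond (cond_conj i (A given H) (B given K) x y) \<noteq> {}"
    and "coherent
           [event_bet (A given H) x,
            event_bet (B given K) y,
            rq_bet (cond_conj i (A given H) (B given K) x y) z,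
            iter_bet i (A given H) (B given K) x y z \<mu>]"
  shows "z = \<mu> * x"
proof -
  let ?bs = "[event_bet (A given H) x,
              event_bet (B given K) y,
              rq_bet (cond_conj i (A given H) (B given K) x y) z,
              iter_bet i (A given H) (B given K) x y z \<mu>]"
  let ?J = "{0, 2, 3} :: nat set"
  define s :: "nat \<Rightarrow> real" where "s = (\<lambda>_. 0)(0 := \<mu>, 2 := - 1, 3 := 1)"
  have gain: "gain ?bs ?J s \<omega> = z - \<mu> * x" for \<omega>
    by (simp add: gain_def s_def event_bet_def rq_bet_def iter_bet_def iter_value_def
        algebra_simps)
  \<comment> \<open>The bet on \<open>A|H\<close> is in force wherever \<open>H\<close> holds, so the sure gain is really at stake.\<close>
  have active: "active_cases ?bs ?J \<noteq> {}"
    using assms(1) by (auto simp: active_cases_def event_bet_def)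
  have "z - \<mu> * x = 0"
    by (rule coherent_sure_gain_zero[OF assms(5) _ _ active gain]) auto
  then show ?thesis by simp
qed

end
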